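(* Let $G$ be a tree, let $p\ge q>1$ be integers, and let $H$ be a finite collection of subgraphs of $G$, each consisting of at most $d$ connected components. If $H$ satisfies the $(p,q)$ property, then $$\tau(H)\le \max\Big\{\frac{2^{\frac{1}{q-1}}(ep)^\frac{q}{q-1}}{q}\, d^{\frac{q}{q-1}} + d,~ 2p^2d\Big\}.$$
   Context: $H$ satisfies the $(p,q)$ property if among any $p$ elements of $H$ there are some $q$ elements sharing a common vertex of $G$. $\tau(H)$ is the minimum size of a set of vertices of $G$ meeting every member of $H$. Here $e$ is Euler's number. *)

theory Defs
  imports Complex_Main "Graph_Theory.Graph_Theory"
begin

text \<open>
  An undirected simple graph, finite or infinite, is a \<^locale>\<open>pair_bidirected_digraph\<close>, an edge
  being a pair of opposite arcs. The library's \<^const>\<open>tree\<close> is unsuitable for these graphs: it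
  forbids all directed cycles, including u, v, u along a single edge. Hence only closed walks with
  at least three distinct vertices count as cycles here.
\<close>

definition undirected_tree :: "'a pair_pre_digraph \<Rightarrow> bool" where
  "undirected_tree G \<longleftrightarrow>
     pair_bidirected_digraph G \<and>
     Digraph_Component.connected (with_proj G) \<and>
     (\<nexists>c. pre_digraph.cycle (with_proj G) c \<and> 3 \<le> length c)"

text \<open>
  Subgraphs are not required to be induced, but must contain both arcs of an edge or neither, and
  the null graph is excluded (no set of vertices could meet it).
\<close>

definition undirected_subgraph :: "'a pair_pre_digraph \<Rightarrow> 'a pair_pre_digraph \<Rightarrow> bool" where
  "undirected_subgraph S G \<longleftrightarrow>
     pair_sym_digraph S \<and> subgraph (with_proj S) (with_proj G) \<and> pverts S \<noteq> {}"

text \<open>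
  In a symmetric digraph the strongly connected components are the connected components. An
  infinite set has cardinality 0, so finiteness is stated separately.
\<close>

definition at_most_components :: "nat \<Rightarrow> 'a pair_pre_digraph \<Rightarrow> bool" where
  "at_most_components d S \<longleftrightarrow>
     finite (pre_digraph.sccs (with_proj S)) \<and> card (pre_digraph.sccs (with_proj S)) \<le> d"

definition pq_property ::
  "'a pair_pre_digraph \<Rightarrow> nat \<Rightarrow> nat \<Rightarrow> 'a pair_pre_digraph set \<Rightarrow> bool" where
  "pq_property G p q H \<longleftrightarrow>
     (\<forall>F. F \<subseteq> H \<and> finite F \<and> card F = p \<longrightarrow>
       (\<exists>F'. F' \<subseteq> F \<and> card F' = q \<and> (\<exists>v \<in> pverts G. \<forall>S \<in> F'. v \<in> pverts S)))"

definition piercing_set ::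
  "'a pair_pre_digraph \<Rightarrow> 'a pair_pre_digraph set \<Rightarrow> 'a set \<Rightarrow> bool" where
  "piercing_set G H X \<longleftrightarrow> X \<subseteq> pverts G \<and> (\<forall>S \<in> H. X \<inter> pverts S \<noteq> {})"

text \<open>
  A finite piercing set exists, and the minimum is attained, whenever \<open>H\<close> is a finite set of
  non-null subgraphs of \<open>G\<close>.
\<close>

definition piercing_number :: "'a pair_pre_digraph \<Rightarrow> 'a pair_pre_digraph set \<Rightarrow> nat" where
  "piercing_number G H = (LEAST n. \<exists>X. finite X \<and> piercing_set G H X \<and> card X = n)"

end

theory Submission
  imports Defs "HOL-Library.FuncSet"
begin

text \<open>
  By linear programming duality, for every \<open>B > 0\<close> either \<open>H\<close> has a fractional cover of total weight
  less than \<open>B\<close>, or there is a probability distribution on \<open>H\<close> for which every vertex lies in a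
  random member with probability at most \<open>1 / B\<close>.

  In the first case some component of each member has weight more than \<open>1 / (d * B)\<close>. For subtrees
  of a tree, the maximal number of disjoint ones equals the piercing number: pick the subtree whose
  apex (vertex closest to the root) is deepest, discard the subtrees containing this apex, repeat.
  Disjoint subtrees of weight at least \<open>1 / (d * B)\<close> number at most \<open>d * B\<close>.

  In the second case draw \<open>p\<close> members independently. They are distinct with probability more than
  \<open>1 / 2\<close> if \<open>B \<ge> 2 * p\<^sup>2\<close>, and then some \<open>q\<close> of them have a common vertex; hence they share the
  apex of a component of one of them, which has probability at most
  \<open>(p choose q) * q * d / B ^ (q - 1)\<close>. So \<open>B\<close> cannot be too large.
\<close>

section \<open>An alternative theorem for convexlike families of functions\<close>

text \<open>The points \<open>(f x, g x)\<close> form a convex set in the plane that misses the open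
  positive quadrant. A line through the origin with normal \<open>(s, 1 - s)\<close> separates the
  two.\<close>

lemma convexlike_pair_alternative:
  fixes f g :: "'x \<Rightarrow> real"
  assumes convexlike: "\<And>x y t. x \<in> X \<Longrightarrow> y \<in> X \<Longrightarrow> 0 \<le> t \<Longrightarrow> t \<le> 1 \<Longrightarrow>
      \<exists>z\<in>X. f z = (1 - t) * f x + t * f y \<and> g z = (1 - t) * g x + t * g y"
    and no_pos: "\<And>x. x \<in> X \<Longrightarrow> f x > 0 \<Longrightarrow> g x \<le> 0"
  shows "\<exists>s. 0 \<le> s \<and> s \<le> 1 \<and> (\<forall>x\<in>X. s * f x + (1 - s) * g x \<le> 0)"
proof -
  \<comment> \<open>Otherwise the segment between the two image points crosses the open positive
    quadrant. The weights \<open>a\<close> and \<open>b\<close> below pick its point on the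
    diagonal, where \<open>f z = g z\<close>.\<close>
  have key: "f x * g y \<le> f y * g x" if xy: "x \<in> X" "y \<in> X" "f x > 0" "g y > 0" for x y
  proof (rule ccontr)
    assume "\<not> ?thesis"
    then have prod: "f x * g y - f y * g x > 0" by simp
    have "g x \<le> 0" "f y \<le> 0" using no_pos that by (force simp: not_le[symmetric])+
    define a b where "a = g y - f y" and "b = f x - g x"
    have pos: "a > 0" "b > 0" using that \<open>g x \<le> 0\<close> \<open>f y \<le> 0\<close> by (auto simp: a_def b_def)
    have t: "0 \<le> b / (a + b)" "b / (a + b) \<le> 1" "1 - b / (a + b) = a / (a + b)"
      using pos by (auto simp: field_simps)
    obtain z where "z \<in> X" and
      z: "f z = a / (a + b) * f x + b / (a + b) * f y" "g z = a / (a + b) * g x + b / (a + b) * g y"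
      using convexlike[OF xy(1,2) t(1,2)] unfolding t(3) by blast
    have "f z = (a * f x + b * f y) / (a + b)" "g z = (a * g x + b * g y) / (a + b)"
      using z by (simp_all add: add_divide_distrib)
    moreover have "a * f x + b * f y = f x * g y - f y * g x" "a * g x + b * g y = f x * g y - f y * g x"
      by (simp_all add: a_def b_def algebra_simps)
    ultimately have "f z > 0" "g z > 0" using prod pos by simp_all
    with no_pos[OF \<open>z \<in> X\<close>] show False by simp
  qed
  consider "\<forall>x\<in>X. g x \<le> 0" | "\<forall>x\<in>X. f x \<le> 0"
    | a b where "a \<in> X" "f a > 0" "b \<in> X" "g b > 0"
    by (meson not_le)
  then show ?thesis
  proof cases
    case 1 then show ?thesis by (intro exI[of _ 0]) auto
  next
    case 2 then show ?thesis by (intro exI[of _ 1]) auto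
  next
    case 3
    \<comment> \<open>A multiplier \<open>t\<close> with \<open>f x + t * g x \<le> 0\<close> must
      be at least every element of \<open>R\<close> and at most \<open>- f y / g y\<close> whenever
      \<open>g y > 0\<close>. By \<open>key\<close> these demands are compatible, so
      \<open>Sup R\<close> meets them all.\<close>
    define R where "R = (\<lambda>x. f x / (- g x)) ` {x \<in> X. f x > 0}"
    have neg: "g x < 0" if "x \<in> X" "f x > 0" for x
    proof -
      have "0 < f b * g x" using key[of x b] that 3 by (smt (verit) mult_pos_pos)
      then show ?thesis using no_pos[OF that] by (metis less_eq_real_def mult_zero_right less_irrefl)
    qed
    have ratio: "r \<le> - f y / g y" if "r \<in> R" "y \<in> X" "g y > 0" for r y
    proof -
      obtain x where x: "x \<in> X" "f x > 0" "r = f x / (- g x)" using \<open>r \<in> R\<close> by (auto simp: R_def)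
      have "f x \<le> f y * g x / g y"
        using key[OF x(1) that(2) x(2) that(3)] that(3) by (simp add: pos_le_divide_eq)
      then show ?thesis using neg[OF x(1,2)] unfolding x(3) by (simp add: neg_le_divide_eq)
    qed
    define t where "t = Sup R"
    have bdd: "bdd_above R" using ratio 3 by (intro bdd_aboveI[of _ "- f b / g b"]) auto
    have ne: "R \<noteq> {}" using 3 by (auto simp: R_def)
    have "0 \<le> f a / (- g a)" using 3 neg[of a] by (simp add: field_simps)
    also have "\<dots> \<le> t" unfolding t_def using 3 by (intro cSup_upper bdd) (auto simp: R_def)
    finally have "t \<ge> 0" .
    have le: "f x + t * g x \<le> 0" if "x \<in> X" for x
    proof -
      consider "f x > 0" | "g x > 0" | "f x \<le> 0" "g x \<le> 0" by linarith
      then show ?thesis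
      proof cases
        case 1
        have "f x / (- g x) \<le> t" unfolding t_def using 1 that by (intro cSup_upper bdd) (auto simp: R_def)
        then show ?thesis using neg[OF that 1] by (simp add: field_simps)
      next
        case 2
        have "t \<le> - f x / g x" unfolding t_def using ratio that 2 by (intro cSup_least ne) auto
        then show ?thesis using 2 by (simp add: field_simps)
      next
        case 3 then show ?thesis using \<open>t \<ge> 0\<close> by (simp add: mult_nonneg_nonpos add_nonpos_nonpos)
      qed
    qed
    \<comment> \<open>Dividing the coefficients \<open>1\<close> and \<open>t\<close> by
      \<open>1 + t\<close> turns them into \<open>s\<close> and \<open>1 - s\<close>.\<close>
    have "1 - 1 / (1 + t) = t / (1 + t)" using \<open>t \<ge> 0\<close> by (simp add: field_simps)
    then have "1 / (1 + t) * f x + (1 - 1 / (1 + t)) * g x = (f x + t * g x) / (1 + t)" for x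
      by (simp add: add_divide_distrib)
    then show ?thesis using le \<open>t \<ge> 0\<close>
      by (intro exI[of _ "1 / (1 + t)"]) (auto simp: divide_nonpos_pos)
  qed
qed

text \<open>This is the duality used for fractional covers. Induction peels off one function
  \<open>f j\<close>: where it is positive, the others have no common positive point, so some convex
  combination \<open>g\<close> of them is nonpositive there. The pair version then merges
  \<open>f j\<close> with \<open>g\<close>.\<close>

lemma convexlike_alternative:
  fixes f :: "'i \<Rightarrow> 'x \<Rightarrow> real"
  assumes "finite I" "I \<noteq> {}"
    and "\<And>x y t. x \<in> X \<Longrightarrow> y \<in> X \<Longrightarrow> 0 \<le> t \<Longrightarrow> t \<le> 1 \<Longrightarrow>
      \<exists>z\<in>X. \<forall>i\<in>I. f i z = (1 - t) * f i x + t * f i y"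
  shows "(\<exists>x\<in>X. \<forall>i\<in>I. f i x > 0) \<or>
    (\<exists>w. (\<forall>i\<in>I. 0 \<le> w i) \<and> sum w I = 1 \<and> (\<forall>x\<in>X. (\<Sum>i\<in>I. w i * f i x) \<le> 0))"
  using assms
proof (induction I arbitrary: X rule: finite_ne_induct)
  case (singleton i)
  then show ?case
    by (cases "\<exists>x\<in>X. f i x > 0") (auto simp: not_less intro!: exI[of _ "\<lambda>_. 1"])
next
  case (insert j I)
  note conv = insert.prems
  define X' where "X' = {x \<in> X. f j x > 0}"
  have conv': "\<exists>z\<in>X'. \<forall>i\<in>I. f i z = (1 - t) * f i x + t * f i y"
    if xy: "x \<in> X'" "y \<in> X'" "0 \<le> t" "t \<le> 1" for x y t
  proof -
    obtain z where z: "z \<in> X" "\<forall>i\<in>insert j I. f i z = (1 - t) * f i x + t * f i y"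
      using conv[of x y t] xy by (auto simp: X'_def)
    have "(1 - t) * f j x + t * f j y > 0" if "0 < f j x" "0 < f j y"
      using that xy(3,4) by (cases "t = 0") (auto intro!: add_nonneg_pos)
    then show ?thesis using z xy by (auto simp: X'_def)
  qed
  show ?case
  proof (cases "\<exists>x\<in>X. \<forall>i\<in>insert j I. f i x > 0")
    case False
    then have "\<not> (\<exists>x\<in>X'. \<forall>i\<in>I. f i x > 0)" by (auto simp: X'_def)
    then obtain w where w: "\<forall>i\<in>I. 0 \<le> w i" "sum w I = 1" "\<forall>x\<in>X'. (\<Sum>i\<in>I. w i * f i x) \<le> 0"
      using insert.IH[OF conv'] by blast
    define g where "g x = (\<Sum>i\<in>I. w i * f i x)" for x
    have "\<exists>s. 0 \<le> s \<and> s \<le> 1 \<and> (\<forall>x\<in>X. s * f j x + (1 - s) * g x \<le> 0)"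
    proof (rule convexlike_pair_alternative)
      fix x y t assume xyt: "x \<in> X" "y \<in> X" "0 \<le> t" "t \<le> (1::real)"
      obtain z where z: "z \<in> X" "\<forall>i\<in>insert j I. f i z = (1 - t) * f i x + t * f i y"
        using conv[OF xyt] by blast
      have "g z = (\<Sum>i\<in>I. (1 - t) * (w i * f i x) + t * (w i * f i y))"
        unfolding g_def using z(2) by (intro sum.cong) (simp_all add: distrib_left mult_ac)
      also have "\<dots> = (1 - t) * g x + t * g y"
        unfolding g_def by (simp add: sum.distrib sum_distrib_left)
      finally show "\<exists>z\<in>X. f j z = (1 - t) * f j x + t * f j y \<and> g z = (1 - t) * g x + t * g y"
        using z by auto
    qed (use w(3) in \<open>auto simp: X'_def g_def\<close>)
    then obtain s where s: "0 \<le> s" "s \<le> 1" "\<forall>x\<in>X. s * f j x + (1 - s) * g x \<le> 0" by blast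
    define w' where "w' i = (if i = j then s else (1 - s) * w i)" for i
    have "(\<Sum>i\<in>insert j I. w' i * h i) = s * h j + (1 - s) * (\<Sum>i\<in>I. w i * h i)" for h
    proof -
      have "(\<Sum>i\<in>I. w' i * h i) = (\<Sum>i\<in>I. (1 - s) * (w i * h i))"
        using insert.hyps by (intro sum.cong) (auto simp: w'_def)
      then show ?thesis using insert.hyps by (simp add: w'_def sum_distrib_left)
    qed
    \<comment> \<open>The first instance computes the total weight of \<open>w'\<close>, the second
      the combined value at a point.\<close>
    from this[of "\<lambda>_. 1"] this[of "\<lambda>i. f i _"] show ?thesis using w s
      by (intro disjI2 exI[of _ w']) (auto simp: w'_def g_def)
  qed blast
qed

section \<open>Families with apices\<close>

text \<open>The greedy choice needs only this from a tree: of two meeting members, the one of larger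
  rank has its apex in the other. For subtrees, \<open>rank\<close> will be the depth of the
  apex.\<close>

lemma disjoint_piercing_subfamily:
  fixes rank :: "'v set \<Rightarrow> nat"
  assumes "finite \<D>"
    and "\<And>C. C \<in> \<D> \<Longrightarrow> apex C \<in> C"
    and "\<And>C C'. C \<in> \<D> \<Longrightarrow> C' \<in> \<D> \<Longrightarrow> C \<inter> C' \<noteq> {} \<Longrightarrow> rank C \<le> rank C' \<Longrightarrow> apex C' \<in> C"
  shows "\<exists>\<E>\<subseteq>\<D>. disjoint \<E> \<and> (\<forall>C\<in>\<D>. \<exists>E\<in>\<E>. apex E \<in> C)"
  using assms
proof (induction "card \<D>" arbitrary: \<D> rule: less_induct)
  case less
  show ?case
  proof (cases "\<D> = {}")
    case False
    then have "Max (rank ` \<D>) \<in> rank ` \<D>" using less.prems(1) by simp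
    then obtain E where "E \<in> \<D>" "rank E = Max (rank ` \<D>)" by auto
    then have E: "E \<in> \<D>" "\<And>C. C \<in> \<D> \<Longrightarrow> rank C \<le> rank E"
      using less.prems(1) by simp_all
    define \<D>' where "\<D>' = {C \<in> \<D>. apex E \<notin> C}"
    \<comment> \<open>\<open>E\<close> contains its own apex and is therefore discarded.\<close>
    have "card \<D>' < card \<D>"
      using E(1) less.prems(1,2) by (intro psubset_card_mono) (auto simp: \<D>'_def)
    then have "\<exists>\<E>\<subseteq>\<D>'. disjoint \<E> \<and> (\<forall>C\<in>\<D>'. \<exists>E\<in>\<E>. apex E \<in> C)"
      by (rule less.hyps) (use less.prems in \<open>auto simp: \<D>'_def\<close>)
    then obtain \<E> where \<E>: "\<E> \<subseteq> \<D>'" "disjoint \<E>" "\<And>C. C \<in> \<D>' \<Longrightarrow> \<exists>E\<in>\<E>. apex E \<in> C"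
      by blast
    have "disjnt E C" if "C \<in> \<E>" for C
    proof -
      have "C \<in> \<D>" "apex E \<notin> C" using that \<E>(1) by (auto simp: \<D>'_def)
      then show ?thesis using less.prems(3)[of C E] E by (auto simp: disjnt_def)
    qed
    then have "disjoint (insert E \<E>)"
      using \<E>(2) by (auto simp: pairwise_insert disjnt_sym)
    moreover have "insert E \<E> \<subseteq> \<D>" using E \<E>(1) by (auto simp: \<D>'_def)
    moreover have "\<exists>E'\<in>insert E \<E>. apex E' \<in> C" if "C \<in> \<D>" for C
      using \<E>(3)[of C] that by (auto simp: \<D>'_def)
    ultimately show ?thesis by blast
  qed auto
qed

lemma sum_UN_le:
  fixes f :: "'b \<Rightarrow> real"
  assumes "finite I" "\<And>i. i \<in> I \<Longrightarrow> finite (A i)" "\<And>x. 0 \<le> f x"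
  shows "sum f (\<Union>i\<in>I. A i) \<le> (\<Sum>i\<in>I. sum f (A i))"
  using assms(1,2)
proof (induction I rule: finite_induct)
  case (insert i I)
  have "sum f (A i \<union> (\<Union>i\<in>I. A i)) \<le> sum f (A i) + sum f (\<Union>i\<in>I. A i)"
    using insert.prems insert.hyps assms(3) by (subst sum_Un) (auto simp: sum_nonneg)
  then show ?case using insert by auto
qed simp

text \<open>This rounds a fractional cover. The weights are scaled to total 1, so a total weight
  below \<open>B\<close> turns into the threshold \<open>1 / B\<close> for each member.\<close>

lemma fractional_cover_imp_cover:
  fixes H :: "'h set" and comps :: "'h \<Rightarrow> 'v set set" and rank :: "'v set \<Rightarrow> nat" and x :: "'v \<Rightarrow> real"
  defines "\<C> \<equiv> \<Union>(comps ` H)"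
  assumes "finite H"
    and comps: "\<And>S. S \<in> H \<Longrightarrow> finite (comps S)" "\<And>S. S \<in> H \<Longrightarrow> card (comps S) \<le> d"
    and apex: "\<And>C. C \<in> \<C> \<Longrightarrow> apex C \<in> C"
    and meet: "\<And>C C'. C \<in> \<C> \<Longrightarrow> C' \<in> \<C> \<Longrightarrow> C \<inter> C' \<noteq> {} \<Longrightarrow> rank C \<le> rank C' \<Longrightarrow> apex C' \<in> C"
    and "finite V" and x: "\<And>v. 0 \<le> x v" "sum x V = 1"
    and "B > 0" and cover: "\<And>S. S \<in> H \<Longrightarrow> 1 / B < sum x (V \<inter> \<Union>(comps S))"
  shows "\<exists>Y. finite Y \<and> real (card Y) \<le> d * B \<and> Y \<subseteq> \<Union>\<C> \<and> (\<forall>S\<in>H. Y \<inter> \<Union>(comps S) \<noteq> {})"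
proof -
  \<comment> \<open>These are the components of weight at least \<open>1 / (d * B)\<close>, written
    without dividing by \<open>d\<close>, whose positivity is established only later.\<close>
  define \<D> where "\<D> = {C \<in> \<C>. 1 \<le> d * B * sum x (V \<inter> C)}"
  have "finite \<C>" using assms(2) comps(1) by (auto simp: \<C>_def)
  then have "finite \<D>" by (auto simp: \<D>_def)
  have "\<exists>\<E>\<subseteq>\<D>. disjoint \<E> \<and> (\<forall>C\<in>\<D>. \<exists>E\<in>\<E>. apex E \<in> C)"
    by (rule disjoint_piercing_subfamily[where rank = rank])
      (use \<open>finite \<D>\<close> apex meet in \<open>auto simp: \<D>_def\<close>)
  then obtain \<E> where \<E>: "\<E> \<subseteq> \<D>" "disjoint \<E>" "\<And>C. C \<in> \<D> \<Longrightarrow> \<exists>E\<in>\<E>. apex E \<in> C"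
    by blast
  have "finite \<E>" using \<E>(1) \<open>finite \<D>\<close> finite_subset by blast
  have "(\<Sum>E\<in>\<E>. sum x (V \<inter> E)) = sum x (\<Union>E\<in>\<E>. V \<inter> E)"
    using \<open>finite \<E>\<close> \<open>finite V\<close> \<E>(2)
    by (intro sum.UNION_disjoint[symmetric]) (auto simp: pairwise_def disjnt_def)
  also have "\<dots> \<le> sum x V" using \<open>finite V\<close> x(1) by (intro sum_mono2) auto
  finally have total: "(\<Sum>E\<in>\<E>. sum x (V \<inter> E)) \<le> 1" using x(2) by simp
  have "real (card \<E>) = (\<Sum>E\<in>\<E>. 1)" by simp
  also have "\<dots> \<le> (\<Sum>E\<in>\<E>. d * B * sum x (V \<inter> E))"
    using \<E>(1) by (intro sum_mono) (auto simp: \<D>_def)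
  also have "\<dots> = d * B * (\<Sum>E\<in>\<E>. sum x (V \<inter> E))" by (simp add: sum_distrib_left)
  also have "\<dots> \<le> d * B * 1" using total \<open>B > 0\<close> by (intro mult_left_mono) auto
  finally have "real (card \<E>) \<le> d * B" by simp
  moreover have "card (apex ` \<E>) \<le> card \<E>" using \<open>finite \<E>\<close> card_image_le by blast
  moreover have "apex ` \<E> \<inter> \<Union>(comps S) \<noteq> {}" if "S \<in> H" for S
  proof -
    \<comment> \<open>Pigeonhole: at most \<open>d\<close> components, each lighter than
      \<open>1 / (d * B)\<close>, cannot carry weight above \<open>1 / B\<close>.\<close>
    have "\<exists>C\<in>comps S. C \<in> \<D>"
    proof (rule ccontr)
      assume "\<not> ?thesis"
      then have small: "d * B * sum x (V \<inter> C) < 1" if "C \<in> comps S" for C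
        using that \<open>S \<in> H\<close> by (auto simp: \<D>_def \<C>_def not_le)
      have "1 / B < sum x (V \<inter> \<Union>(comps S))" using cover that .
      also have "V \<inter> \<Union>(comps S) = (\<Union>C\<in>comps S. V \<inter> C)" by auto
      also have "sum x \<dots> \<le> (\<Sum>C\<in>comps S. sum x (V \<inter> C))"
        using comps(1) that \<open>finite V\<close> x(1) by (intro sum_UN_le) auto
      finally have *: "1 < B * (\<Sum>C\<in>comps S. sum x (V \<inter> C))"
        using \<open>B > 0\<close> by (simp add: field_simps)
      then have "comps S \<noteq> {}" by auto
      then have "d > 0" using comps[OF that] by (metis card_gt_0_iff less_le_trans)
      have "d * 1 < d * (B * (\<Sum>C\<in>comps S. sum x (V \<inter> C)))"
        using * \<open>d > 0\<close> by simp
      also have "\<dots> = (\<Sum>C\<in>comps S. d * B * sum x (V \<inter> C))" by (simp add: sum_distrib_left mult_ac)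
      also have "\<dots> \<le> (\<Sum>C\<in>comps S. 1)" using small by (intro sum_mono) force
      also have "\<dots> \<le> d" using comps(2)[OF that] by simp
      finally show False by simp
    qed
    then show ?thesis using \<E>(3) by blast
  qed
  moreover have "apex ` \<E> \<subseteq> \<Union>\<C>" using \<E>(1) apex by (auto simp: \<D>_def)
  ultimately show ?thesis using \<open>finite \<E>\<close> by (intro exI[of _ "apex ` \<E>"]) auto
qed

section \<open>Counting intersecting tuples\<close>

text \<open>The number \<open>q ^ q / fact q\<close> is one term of the series for
  \<open>exp q\<close>. Combine this with \<open>(p choose q) * fact q \<le> p ^ q\<close>.\<close>

lemma binomial_le_exp:
  assumes "q > 0"
  shows "real (p choose q) \<le> (exp 1 * p / q) ^ q"
proof -
  have "real q ^ q / fact q \<le> (\<Sum>n. real q ^ n /\<^sub>R fact n)"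
    using sum_le_suminf[OF summable_exp_generic[of "real q"], of "{q}"]
    by (simp add: divide_inverse mult.commute)
  also have "\<dots> = exp 1 ^ q" using exp_of_nat_mult[of q "1 :: real"] by (simp add: exp_def)
  finally have "real q ^ q \<le> exp 1 ^ q * fact q" by (simp add: field_simps)
  then have "real (p choose q) * real q ^ q \<le> exp 1 ^ q * real ((p choose q) * fact q)"
    by (auto dest: mult_left_mono[of _ _ "real (p choose q)"] simp: mult_ac)
  also have "\<dots> \<le> exp 1 ^ q * real (p ^ q)"
    using binomial_fact_pow[of p q] by (intro mult_left_mono) (auto simp del: of_nat_mult of_nat_power)
  finally show ?thesis using assms by (simp add: field_simps power_mult_distrib power_divide)
qed

text \<open>
  \<open>P v T\<close> stands for \<open>v\<close> being a vertex of \<open>T\<close>. The estimate is the union bound for the coordinates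
  of a random element of \<open>H\<^sup>p\<close>: two of them coincide, or some \<open>q\<close> of them share an apex of one of
  these \<open>q\<close>.
\<close>

lemma weighted_pq_count:
  fixes w :: "'h \<Rightarrow> real" and apices :: "'h \<Rightarrow> 'v set" and c :: real and p q d :: nat
  assumes "finite H" "H \<noteq> {}"
    and w: "\<And>S. 0 \<le> w S" "sum w H = 1"
    and apices: "\<And>S. S \<in> H \<Longrightarrow> finite (apices S)" "\<And>S. S \<in> H \<Longrightarrow> card (apices S) \<le> d"
      "\<And>S. S \<in> H \<Longrightarrow> w S \<le> c"
    and light: "\<And>S v. S \<in> H \<Longrightarrow> v \<in> apices S \<Longrightarrow> sum w {T \<in> H. P v T} \<le> c"
    and pq: "\<And>F. F \<subseteq> H \<Longrightarrow> card F = p \<Longrightarrow>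
      \<exists>F'\<subseteq>F. card F' = q \<and> (\<exists>S\<in>F'. \<exists>v\<in>apices S. \<forall>T\<in>F'. P v T)"
  shows "1 \<le> real (p * (p - 1)) * c + real (p choose q) * (q * (d * c ^ (q - 1)))"
proof -
  have "c \<ge> 0" using apices(3) w(1) \<open>H \<noteq> {}\<close> by (meson order_trans ex_in_conv)
  define K where "K = {..<p}"
  \<comment> \<open>Product measure: \<open>\<mu> A\<close> is the probability that \<open>p\<close>
    independent draws from \<open>w\<close> form a tuple in \<open>A\<close>.\<close>
  define \<mu> where "\<mu> = sum (\<lambda>f. \<Prod>k\<in>K. w (f k))"
  have pos: "0 \<le> (\<Prod>k\<in>K. w (f k))" for f using w(1) by (simp add: prod_nonneg)
  have box: "\<mu> (PiE K A) = (\<Prod>k\<in>K. sum w (A k))" if "\<And>k. k \<in> K \<Longrightarrow> A k \<subseteq> H" for A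
    unfolding \<mu>_def using that \<open>finite H\<close>
    by (subst prod_sum_PiE) (auto simp: K_def intro: finite_subset)
  define \<Omega> where "\<Omega> = (K \<rightarrow>\<^sub>E H)"
  have fin: "finite \<Omega>" using \<open>finite H\<close> by (auto simp: \<Omega>_def K_def intro!: finite_PiE)
  have fin_sub: "finite A" if "A \<subseteq> \<Omega>" for A using that fin finite_subset by blast
  have UN: "\<mu> (\<Union>i\<in>I. A i) \<le> real (card I) * m"
    if "finite I" "\<And>i. i \<in> I \<Longrightarrow> A i \<subseteq> \<Omega>" "\<And>i. i \<in> I \<Longrightarrow> \<mu> (A i) \<le> m" for I :: "'i set" and A and m :: real
    using sum_UN_le[of I A "\<lambda>f. \<Prod>k\<in>K. w (f k)"] that fin_sub pos sum_bounded_above[of I "\<lambda>i. \<mu> (A i)" m]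
    unfolding \<mu>_def by force
  \<comment> \<open>A union over the value \<open>S\<close> of one coordinate costs no factor
    \<open>card H\<close>, because the bounds \<open>w S * m\<close> add up to
    \<open>m\<close>.\<close>
  have UNH: "\<mu> (\<Union>S\<in>H. A S) \<le> m"
    if "\<And>S. S \<in> H \<Longrightarrow> A S \<subseteq> \<Omega>" "\<And>S. S \<in> H \<Longrightarrow> \<mu> (A S) \<le> w S * m" for A m
  proof -
    have "\<mu> (\<Union>S\<in>H. A S) \<le> (\<Sum>S\<in>H. \<mu> (A S))"
      unfolding \<mu>_def using that fin_sub pos \<open>finite H\<close> by (intro sum_UN_le) auto
    also have "\<dots> \<le> (\<Sum>S\<in>H. w S * m)" using that by (intro sum_mono) auto
    finally show ?thesis using w(2) by (simp add: sum_distrib_right[symmetric])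
  qed

  \<comment> \<open>Each coordinate outside \<open>J\<close> is free and contributes the factor
    \<open>sum w H = 1\<close>.\<close>
  have cylinder: "\<mu> {f \<in> \<Omega>. \<forall>k\<in>J. f k \<in> A k} = (\<Prod>k\<in>J. sum w (A k))"
    if "J \<subseteq> K" "\<And>k. k \<in> J \<Longrightarrow> A k \<subseteq> H" for J A
  proof -
    define A' where "A' k = (if k \<in> J then A k else H)" for k
    have "{f \<in> \<Omega>. \<forall>k\<in>J. f k \<in> A k} = PiE K A'"
    proof (rule set_eqI)
      fix f
      have "(\<forall>k\<in>K. f k \<in> H) \<and> (\<forall>k\<in>J. f k \<in> A k) \<longleftrightarrow> (\<forall>k\<in>K. f k \<in> A' k)"
        unfolding A'_def using that by (metis subsetD)
      then show "f \<in> {f \<in> \<Omega>. \<forall>k\<in>J. f k \<in> A k} \<longleftrightarrow> f \<in> PiE K A'"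
        by (auto simp: \<Omega>_def PiE_iff)
    qed
    also have "\<mu> (PiE K A') = (\<Prod>k\<in>K. sum w (A' k))" using that by (intro box) (auto simp: A'_def)
    also have "\<dots> = (\<Prod>k\<in>J. sum w (A' k))"
      using that w(2) by (intro prod.mono_neutral_right) (auto simp: K_def A'_def)
    finally show ?thesis by (simp add: A'_def)
  qed

  define same where "same = (\<lambda>(i, j) S. {f \<in> \<Omega>. \<forall>k\<in>{i, j}. f k \<in> {S}})"
  \<comment> \<open>The pairs are ordered, so every coincidence is counted twice.\<close>
  define D where "D = {(i, j) \<in> K \<times> K. i \<noteq> j}"
  have "\<mu> (\<Union>S\<in>H. same ij S) \<le> c" if ijD: "ij \<in> D" for ij
  proof (rule UNH)
    fix S assume "S \<in> H"
    obtain i j where ij: "ij = (i, j)" "i \<in> K" "j \<in> K" "i \<noteq> j" using ijD by (auto simp: D_def)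
    have "\<mu> (same ij S) = (\<Prod>k\<in>{i, j}. sum w {S})"
      using ij \<open>S \<in> H\<close> cylinder[of "{i, j}" "\<lambda>_. {S}"] by (simp add: same_def)
    then show "\<mu> (same ij S) \<le> w S * c"
      using ij apices(3)[OF \<open>S \<in> H\<close>] w(1)[of S] by (simp add: mult_left_mono)
  qed (auto simp: same_def split: prod.splits)
  moreover have "finite D" "card D = p * (p - 1)"
  proof -
    have D: "D = K \<times> K - (\<lambda>i. (i, i)) ` K" by (auto simp: D_def)
    moreover have "card ((\<lambda>i. (i, i)) ` K) = p" by (simp add: card_image inj_on_def K_def)
    ultimately show "card D = p * (p - 1)"
      unfolding D by (subst card_Diff_subset) (auto simp: K_def diff_mult_distrib2)
    show "finite D" unfolding D by (simp add: K_def)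
  qed
  ultimately have coincide: "\<mu> (\<Union>ij\<in>D. \<Union>S\<in>H. same ij S) \<le> real (p * (p - 1)) * c"
    using UN[of D "\<lambda>ij. \<Union>S\<in>H. same ij S" c] by (force simp: same_def)

  \<comment> \<open>Coordinate \<open>i\<close> is pinned to the member \<open>S\<close> that owns
    the apex \<open>v\<close>. It contributes at most \<open>w S\<close>, and the other
    \<open>q - 1\<close> coordinates at most \<open>c\<close> each.\<close>
  define meet where "meet I i S v = {f \<in> \<Omega>. \<forall>k\<in>I. f k \<in> {T \<in> H. (k = i \<longrightarrow> T = S) \<and> P v T}}" for I i S v
  define \<I> where "\<I> = {I. I \<subseteq> K \<and> card I = q}"
  have \<I>: "finite \<I>" "card \<I> = p choose q" by (simp_all add: \<I>_def n_subsets K_def)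
  have "\<mu> (\<Union>v\<in>apices S. meet I i S v) \<le> w S * (d * c ^ (q - 1))" if "I \<in> \<I>" "i \<in> I" "S \<in> H" for I i S
  proof -
    have I: "I \<subseteq> K" "card I = q" "finite I" using that by (auto simp: \<I>_def K_def intro: finite_subset)
    have "\<mu> (meet I i S v) \<le> w S * c ^ (q - 1)" if "v \<in> apices S" for v
    proof -
      define A where "A k = {T \<in> H. (k = i \<longrightarrow> T = S) \<and> P v T}" for k
      have "\<mu> (meet I i S v) = (\<Prod>k\<in>I. sum w (A k))"
        using cylinder[OF I(1), of A] by (simp add: meet_def A_def)
      also have "\<dots> = sum w (A i) * (\<Prod>k\<in>I - {i}. sum w (A k))"
        using I \<open>i \<in> I\<close> by (simp add: prod.remove)
      also have "\<dots> \<le> w S * (\<Prod>k\<in>I - {i}. c)"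
      proof (intro mult_mono prod_mono conjI)
        have "sum w (A i) \<le> sum w {S}"
          using w(1) by (intro sum_mono2) (auto simp: A_def)
        then show "sum w (A i) \<le> w S" by simp
      qed (use w(1) light[OF \<open>S \<in> H\<close> that] in \<open>auto simp: A_def intro!: sum_nonneg zero_le_power\<close>)
      also have "(\<Prod>k\<in>I - {i}. c) = c ^ (q - 1)" using I \<open>i \<in> I\<close> by simp
      finally show ?thesis .
    qed
    then have "\<mu> (\<Union>v\<in>apices S. meet I i S v) \<le> card (apices S) * (w S * c ^ (q - 1))"
      using apices(1) \<open>S \<in> H\<close> by (intro UN) (auto simp: meet_def)
    also have "\<dots> \<le> d * (w S * c ^ (q - 1))"
      using apices(2) \<open>S \<in> H\<close> w(1) \<open>c \<ge> 0\<close> by (intro mult_right_mono) auto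
    finally show ?thesis by (simp add: mult_ac)
  qed
  then have "\<mu> (\<Union>S\<in>H. \<Union>v\<in>apices S. meet I i S v) \<le> d * c ^ (q - 1)" if "I \<in> \<I>" "i \<in> I" for I i
    using that by (intro UNH) (auto simp: meet_def)
  then have "\<mu> (\<Union>i\<in>I. \<Union>S\<in>H. \<Union>v\<in>apices S. meet I i S v) \<le> card I * (d * c ^ (q - 1))" if "I \<in> \<I>" for I
    using that by (intro UN) (auto simp: meet_def \<I>_def K_def intro: finite_subset)
  then have "\<mu> (\<Union>I\<in>\<I>. \<Union>i\<in>I. \<Union>S\<in>H. \<Union>v\<in>apices S. meet I i S v) \<le> card \<I> * (q * (d * c ^ (q - 1)))"
    using \<I>(1) by (intro UN) (auto simp: meet_def \<I>_def)
  then have intersect: "\<mu> (\<Union>I\<in>\<I>. \<Union>i\<in>I. \<Union>S\<in>H. \<Union>v\<in>apices S. meet I i S v) \<le>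
      real (p choose q) * (q * (d * c ^ (q - 1)))" using \<I>(2) by simp

  define E where "E = (\<Union>ij\<in>D. \<Union>S\<in>H. same ij S)"
  define E' where "E' = (\<Union>I\<in>\<I>. \<Union>i\<in>I. \<Union>S\<in>H. \<Union>v\<in>apices S. meet I i S v)"
  \<comment> \<open>Outside \<open>E\<close> the tuple is injective, so \<open>pq\<close> applies to
    its image. The \<open>q\<close> members obtained are pulled back to an index set
    \<open>I\<close>.\<close>
  have "f \<in> E'" if "f \<in> \<Omega>" "f \<notin> E" for f
  proof -
    have fH: "f k \<in> H" if "k \<in> K" for k using that \<open>f \<in> \<Omega>\<close> by (auto simp: \<Omega>_def)
    have inj: "inj_on f K"
      using that fH by (fastforce simp: E_def same_def D_def inj_on_def)
    have "f ` K \<subseteq> H" "card (f ` K) = p" using fH inj by (auto simp: card_image K_def)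
    then obtain F' S v where F': "F' \<subseteq> f ` K" "card F' = q" "S \<in> F'" "v \<in> apices S" "\<forall>T\<in>F'. P v T"
      using pq[of "f ` K"] by blast
    obtain I where I: "I \<subseteq> K" "F' = f ` I" using F'(1) by (meson subset_image_iff)
    then have "card I = q" using F'(2) inj by (metis card_image inj_on_subset)
    moreover obtain i where "i \<in> I" "S = f i" using F'(3) I by blast
    ultimately have "I \<in> \<I>" "i \<in> I" "S \<in> H" "f \<in> meet I i S v"
      using that(1) F' I fH by (auto simp: meet_def \<I>_def)
    then show ?thesis using \<open>v \<in> apices S\<close> unfolding E'_def by blast
  qed
  then have "\<Omega> \<subseteq> E \<union> E'" by blast
  moreover have sub: "E \<subseteq> \<Omega>" "E' \<subseteq> \<Omega>" by (auto simp: E_def E'_def same_def meet_def)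
  ultimately have "\<Omega> = E \<union> E'" by blast
  have "1 = \<mu> \<Omega>" using w(2) by (simp add: \<Omega>_def box)
  also have "\<dots> = \<mu> (E \<union> E')" using \<open>\<Omega> = E \<union> E'\<close> by simp
  also have "\<dots> \<le> \<mu> E + \<mu> E'"
    using sub fin_sub pos unfolding \<mu>_def by (subst sum_Un) (auto simp: sum_nonneg)
  finally show ?thesis using coincide intersect unfolding E_def E'_def by linarith
qed

text \<open>The two bounds on \<open>B\<close> make both error terms of the tuple count with
  \<open>c = 1 / B\<close> at most 1/2, the first strictly. This refutes the second alternative of
  the duality, and the fractional cover of the first is rounded.\<close>

lemma pq_piercing_set:
  fixes H :: "'h set" and comps :: "'h \<Rightarrow> 'v set set" and rank :: "'v set \<Rightarrow> nat" and B :: real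
    and p q d :: nat
  defines "\<C> \<equiv> \<Union>(comps ` H)"
  assumes "finite H" "H \<noteq> {}" "q > 1" "p \<ge> q"
    and comps: "\<And>S. S \<in> H \<Longrightarrow> finite (comps S)" "\<And>S. S \<in> H \<Longrightarrow> card (comps S) \<le> d"
      "\<And>S. S \<in> H \<Longrightarrow> comps S \<noteq> {}"
    and apex: "\<And>C. C \<in> \<C> \<Longrightarrow> apex C \<in> C"
    and meet: "\<And>C C'. C \<in> \<C> \<Longrightarrow> C' \<in> \<C> \<Longrightarrow> C \<inter> C' \<noteq> {} \<Longrightarrow> rank C \<le> rank C' \<Longrightarrow> apex C' \<in> C"
    and pq: "\<And>F. F \<subseteq> H \<Longrightarrow> card F = p \<Longrightarrow>
      \<exists>F'\<subseteq>F. card F' = q \<and> (\<exists>v. \<forall>S\<in>F'. v \<in> \<Union>(comps S))"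
    and B: "2 * real p ^ 2 \<le> B" "2 * real d * real q * (exp 1 * p / q) ^ q \<le> B ^ (q - 1)"
  shows "\<exists>Y. finite Y \<and> real (card Y) \<le> d * B \<and> Y \<subseteq> \<Union>\<C> \<and> (\<forall>S\<in>H. Y \<inter> \<Union>(comps S) \<noteq> {})"
proof -
  have "p > 0" using assms by simp
  then have "B > 0" using B(1) by (smt (verit) of_nat_0_less_iff zero_less_power)
  \<comment> \<open>Weights are measured on the finitely many apices only, since the tree may be
    infinite.\<close>
  define V where "V = apex ` \<C>"
  have "finite V" using assms(2) comps(1) by (auto simp: V_def \<C>_def)
  define X where "X = {x :: 'v \<Rightarrow> real. (\<forall>v. 0 \<le> x v) \<and> sum x V = 1}"
  define f where "f S x = sum x (V \<inter> \<Union>(comps S)) - 1 / B" for S x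
  have "\<exists>z\<in>X. \<forall>S\<in>H. f S z = (1 - t) * f S x + t * f S y"
    if "x \<in> X" "y \<in> X" "0 \<le> t" "t \<le> 1" for x y t
  proof
    let ?z = "\<lambda>v. (1 - t) * x v + t * y v"
    have sum_z: "sum ?z A = (1 - t) * sum x A + t * sum y A" for A
      by (simp add: sum.distrib sum_distrib_left)
    show "?z \<in> X" using that by (auto simp: X_def sum_z)
    show "\<forall>S\<in>H. f S ?z = (1 - t) * f S x + t * f S y"
      unfolding f_def sum_z by (simp add: algebra_simps add_divide_distrib[symmetric])
  qed
  from convexlike_alternative[OF assms(2,3) this] show ?thesis
  proof
    assume "\<exists>x\<in>X. \<forall>S\<in>H. f S x > 0"
    then obtain x where "x \<in> X" "\<And>S. S \<in> H \<Longrightarrow> f S x > 0" by blast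
    then show ?thesis unfolding \<C>_def
      by (intro fractional_cover_imp_cover[where apex = apex and rank = rank and V = V and x = x])
        (use assms(2) comps(1,2) apex meet \<open>finite V\<close> \<open>B > 0\<close> in \<open>simp_all add: X_def f_def \<C>_def\<close>)
  next
    assume "\<exists>w. (\<forall>S\<in>H. 0 \<le> w S) \<and> sum w H = 1 \<and> (\<forall>x\<in>X. (\<Sum>S\<in>H. w S * f S x) \<le> 0)"
    then obtain w where w: "\<forall>S\<in>H. 0 \<le> w S" "sum w H = 1" "\<forall>x\<in>X. (\<Sum>S\<in>H. w S * f S x) \<le> 0" by blast
    \<comment> \<open>The counting lemma asks for weights that are nonnegative on the whole type,
      hence the default 0.\<close>
    define w' where "w' S = (if S \<in> H then w S else 0)" for S
    have light: "sum w' {T \<in> H. v \<in> \<Union>(comps T)} \<le> 1 / B" if "v \<in> V" for v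
    proof -
      \<comment> \<open>Testing the dual weights against the point mass at \<open>v\<close> bounds
        the probability of containing \<open>v\<close>.\<close>
      define x where "x u = (if u = v then 1 else 0 :: real)" for u
      have x: "sum x A = (if v \<in> A then 1 else 0)" if "finite A" for A
        using that by (simp add: x_def)
      have "x \<in> X" using x[OF \<open>finite V\<close>] that by (auto simp: X_def) (simp add: x_def)
      then have "0 \<ge> (\<Sum>S\<in>H. w S * f S x)" using w(3) by blast
      also have "(\<Sum>S\<in>H. w S * f S x) = (\<Sum>S\<in>H. (if v \<in> \<Union>(comps S) then w' S else 0) - w S * (1 / B))"
        using that \<open>finite V\<close> by (intro sum.cong) (auto simp: f_def x w'_def algebra_simps)
      also have "\<dots> = sum w' {T \<in> H. v \<in> \<Union>(comps T)} - 1 / B"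
        using assms(2) w(2) by (simp add: sum_subtractf sum.inter_filter sum_divide_distrib[symmetric])
      finally show ?thesis by simp
    qed
    have "1 \<le> real (p * (p - 1)) * (1 / B) + real (p choose q) * (q * (d * (1 / B) ^ (q - 1)))"
    proof (rule weighted_pq_count[where H = H and w = w' and apices = "\<lambda>S. apex ` comps S"
          and P = "\<lambda>v T. v \<in> \<Union>(comps T)"])
      show "0 \<le> w' S" for S using w(1) by (simp add: w'_def)
      show "sum w' H = 1" using w(2) by (simp add: w'_def)
      fix S assume "S \<in> H"
      show "finite (apex ` comps S)" using comps \<open>S \<in> H\<close> by simp
      show "card (apex ` comps S) \<le> d" using comps \<open>S \<in> H\<close> by (meson card_image_le order_trans)
      show "sum w' {T \<in> H. v \<in> \<Union>(comps T)} \<le> 1 / B" if "v \<in> apex ` comps S" for v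
        using that \<open>S \<in> H\<close> by (intro light) (auto simp: V_def \<C>_def)
      \<comment> \<open>One member weighs no more than all members through the apex of one of its
        components.\<close>
      obtain C where C: "C \<in> comps S" using comps(3) \<open>S \<in> H\<close> by blast
      then have "C \<in> \<C>" using \<open>S \<in> H\<close> by (auto simp: \<C>_def)
      then have "w' S \<le> sum w' {T \<in> H. apex C \<in> \<Union>(comps T)}"
        using C \<open>S \<in> H\<close> apex assms(2) w(1) by (intro member_le_sum) (auto simp: w'_def)
      also have "\<dots> \<le> 1 / B" using \<open>C \<in> \<C>\<close> by (intro light) (auto simp: V_def)
      finally show "w' S \<le> 1 / B" .
    next
      fix F assume F: "F \<subseteq> H" "card F = p"
      then obtain F' v where F': "F' \<subseteq> F" "card F' = q" "\<forall>S\<in>F'. v \<in> \<Union>(comps S)"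
        using pq[OF F] by blast
      \<comment> \<open>The common vertex \<open>v\<close> is traded for an apex: the chosen
        components \<open>K S\<close> all meet in \<open>v\<close>, so the apex of the one with
        largest rank lies in all of them.\<close>
      then have "\<forall>S\<in>F'. \<exists>C. C \<in> comps S \<and> v \<in> C" by blast
      then obtain K where K: "\<And>S. S \<in> F' \<Longrightarrow> K S \<in> comps S" "\<And>S. S \<in> F' \<Longrightarrow> v \<in> K S" by metis
      have "finite F'" "F' \<noteq> {}" using F'(2) \<open>q > 1\<close> by (auto intro: card_ge_0_finite)
      then have "Max ((\<lambda>S. rank (K S)) ` F') \<in> (\<lambda>S. rank (K S)) ` F'" by simp
      then obtain S where "S \<in> F'" "rank (K S) = Max ((\<lambda>S. rank (K S)) ` F')" by auto
      then have S: "S \<in> F'" "\<And>T. T \<in> F' \<Longrightarrow> rank (K T) \<le> rank (K S)" using \<open>finite F'\<close> by simp_all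
      have "K T \<in> \<C>" if "T \<in> F'" for T using K(1) that F'(1) F(1) by (auto simp: \<C>_def)
      then have "apex (K S) \<in> K T" if "T \<in> F'" for T
        using meet[of "K T" "K S"] K(2) S that by blast
      then have "\<forall>T\<in>F'. apex (K S) \<in> \<Union>(comps T)" using K(1) by blast
      moreover have "apex (K S) \<in> apex ` comps S" using K(1) S(1) by simp
      ultimately show "\<exists>F'\<subseteq>F. card F' = q \<and> (\<exists>S\<in>F'. \<exists>v\<in>apex ` comps S. \<forall>T\<in>F'. v \<in> \<Union>(comps T))"
        using F'(1,2) S(1) by (intro exI[of _ F'] conjI bexI[of _ S] bexI[of _ "apex (K S)"])
    qed (use assms in auto)
    moreover have "real (p * (p - 1)) * (1 / B) < 1 / 2"
    proof -
      have "p * (p - 1) < p ^ 2" using \<open>p > 0\<close> by (simp add: power2_eq_square)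
      then have "real (p * (p - 1)) < real p ^ 2" by (metis of_nat_less_iff of_nat_power)
      then show ?thesis using B(1) \<open>B > 0\<close> by (simp add: field_simps)
    qed
    moreover have "real (p choose q) * (q * (d * (1 / B) ^ (q - 1))) \<le> 1 / 2"
    proof -
      have "real (p choose q) * (2 * real d * real q) \<le> (exp 1 * p / q) ^ q * (2 * real d * real q)"
        using \<open>q > 1\<close> by (intro mult_right_mono binomial_le_exp) auto
      also have "\<dots> \<le> B ^ (q - 1)" using B(2) by (simp add: mult_ac)
      finally show ?thesis using \<open>B > 0\<close> by (simp add: field_simps power_divide)
    qed
    ultimately show ?thesis by linarith
  qed
qed

section \<open>Rooted trees\<close>

definition reach :: "'a rel \<Rightarrow> 'a set \<Rightarrow> 'a \<Rightarrow> 'a \<Rightarrow> bool" where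
  "reach R A u v \<longleftrightarrow> u \<in> A \<and> (u, v) \<in> (R \<inter> A \<times> A)\<^sup>*"

lemma reach_refl: "u \<in> A \<Longrightarrow> reach R A u u"
  by (simp add: reach_def)

lemma reach_in: assumes "reach R A u v" shows "u \<in> A" "v \<in> A"
  using assms unfolding reach_def by (auto elim: rtrancl.cases)

lemma reach_step: "reach R A u v \<Longrightarrow> (v, w) \<in> R \<Longrightarrow> w \<in> A \<Longrightarrow> reach R A u w"
  using reach_in(2)[of R A u v] unfolding reach_def by (auto intro: rtrancl_into_rtrancl)

lemma reach_induct [consumes 1, case_names refl step]:
  assumes "reach R A u v" and "u \<in> A \<Longrightarrow> P u"
    and "\<And>v w. reach R A u v \<Longrightarrow> P v \<Longrightarrow> (v, w) \<in> R \<Longrightarrow> v \<in> A \<Longrightarrow> w \<in> A \<Longrightarrow> P w"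
  shows "P v"
proof -
  have "(u, v) \<in> (R \<inter> A \<times> A)\<^sup>*" "u \<in> A" using assms(1) by (auto simp: reach_def)
  then show ?thesis
    by (induction rule: rtrancl_induct) (use assms(2,3) in \<open>auto simp: reach_def\<close>)
qed

lemma reach_trans: "reach R A u v \<Longrightarrow> reach R A v w \<Longrightarrow> reach R A u w"
  by (auto simp: reach_def)

lemma reach_sym: "sym R \<Longrightarrow> reach R A u v \<Longrightarrow> reach R A v u"
  using reach_in(2)[of R A u v] sym_rtrancl[of "R \<inter> A \<times> A"]
  by (auto simp: reach_def sym_def)

lemma reach_mono: "reach R A u v \<Longrightarrow> A \<subseteq> B \<Longrightarrow> reach R B u v"
  unfolding reach_def using rtrancl_mono[of "R \<inter> A \<times> A" "R \<inter> B \<times> B"] by blast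

lemma reach_if_strongly_connected:
  assumes "strongly_connected D" "arcs_ends D \<subseteq> R" "u \<in> verts D" "v \<in> verts D"
  shows "reach R (verts D) u v"
proof -
  have "(u, v) \<in> rtrancl_on (verts D) (arcs_ends D)"
    using assms by (auto simp: strongly_connected_def reachable_def)
  then show ?thesis
    by (induction rule: rtrancl_on_induct) (use assms(2) in \<open>auto intro: reach_refl reach_step\<close>)
qed

lemma reach_imp_path:
  assumes "reach R A u v"
  obtains p where "p \<noteq> []" "hd p = u" "last p = v" "distinct p" "set p \<subseteq> A" "set (vwalk_arcs p) \<subseteq> R"
proof -
  have "\<exists>p. p \<noteq> [] \<and> hd p = u \<and> last p = v \<and> distinct p \<and> set p \<subseteq> A \<and> set (vwalk_arcs p) \<subseteq> R"
    using assms
  proof (induction rule: reach_induct)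
    case refl
    then show ?case by (intro exI[of _ "[u]"]) auto
  next
    case (step v w)
    then obtain p where p: "p \<noteq> []" "hd p = u" "last p = v" "distinct p" "set p \<subseteq> A"
      "set (vwalk_arcs p) \<subseteq> R" by blast
    show ?case
    \<comment> \<open>If the path has already visited \<open>w\<close>, it is cut back to that
      visit.\<close>
    proof (cases "w \<in> set p")
      case True
      then obtain p1 p2 where "p = (p1 @ [w]) @ p2" by (auto simp: in_set_conv_decomp)
      then show ?thesis using p set_vwalk_arcs_append1[of "p1 @ [w]" p2]
        by (intro exI[of _ "p1 @ [w]"]) (auto simp: hd_append split: if_splits)
    next
      case False
      then show ?thesis using p step by (intro exI[of _ "p @ [w]"]) (auto simp: vwalk_arcs_append)
    qed
  qed
  then show ?thesis using that by blast
qed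

lemma pawalk_verts_vwalk_arcs: "p \<noteq> [] \<Longrightarrow> pawalk_verts (hd p) (vwalk_arcs p) = p"
  by (induction p rule: vwalk_arcs.induct) auto

lemma pcas_vwalk_arcs: "p \<noteq> [] \<Longrightarrow> pcas (hd p) (vwalk_arcs p) (last p)"
  by (induction p rule: vwalk_arcs.induct) auto

text \<open>A path in \<open>A\<close> from \<open>x\<close> to \<open>y\<close> and one in
  \<open>B\<close> from \<open>y'\<close> to \<open>x'\<close>, joined by the two arcs, close up to
  a simple cycle. If \<open>x\<close> and \<open>y\<close> differ, it has at least two vertices in
  \<open>A\<close> and one in \<open>B\<close>.\<close>

lemma (in pair_wf_digraph) no_disjoint_detours:
  assumes acyclic: "\<nexists>c. pre_digraph.cycle (with_proj G) c \<and> 3 \<le> length c"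
    and "reach (parcs G) A x y" "reach (parcs G) B y' x'" "A \<inter> B = {}"
    and arcs: "(y, y') \<in> parcs G" "(x', x) \<in> parcs G"
  shows "x = y"
proof (rule ccontr)
  assume "x \<noteq> y"
  obtain p where p: "p \<noteq> []" "hd p = x" "last p = y" "distinct p" "set p \<subseteq> A" "set (vwalk_arcs p) \<subseteq> parcs G"
    using reach_imp_path[OF assms(2)] by blast
  obtain q where q: "q \<noteq> []" "hd q = y'" "last q = x'" "distinct q" "set q \<subseteq> B" "set (vwalk_arcs q) \<subseteq> parcs G"
    using reach_imp_path[OF assms(3)] by blast
  define c where "c = vwalk_arcs (p @ q @ [x])"
  have verts: "pawalk_verts x c = p @ q @ [x]" and "pcas x c x"
    using pawalk_verts_vwalk_arcs[of "p @ q @ [x]"] pcas_vwalk_arcs[of "p @ q @ [x]"] p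
    by (simp_all add: c_def)
  have "length p \<ge> 2" "length q \<ge> 1"
    using p(1-3) q(1) \<open>x \<noteq> y\<close> by (cases p; cases "tl p"; auto simp: Suc_le_eq)+
  \<comment> \<open>The repeated end vertex \<open>x\<close> makes the number of arcs exactly
    \<open>length p + length q\<close>.\<close>
  then have "length c \<ge> 3" 
    using vwalk_length_simp[of "p @ q @ [x]"] unfolding c_def vwalk_length_def by simp
  moreover have "cycle c"
    unfolding cycle_def awalk_def
  proof (intro exI[of _ x] conjI)
    show "x \<in> pverts G" using in_arcsD2 arcs by blast
    show "set c \<subseteq> parcs G" using p q arcs by (simp add: c_def vwalk_arcs_append)
    show "distinct (tl (pawalk_verts x c))"
      using p q \<open>A \<inter> B = {}\<close> unfolding verts by (cases p) auto
    show "c \<noteq> []" using \<open>length c \<ge> 3\<close> by auto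
  qed fact
  ultimately show False using acyclic by blast
qed

text \<open>Instead of unique paths from the root \<open>r\<close>, the order of the tree is represented by domination:
  \<open>u\<close> is an ancestor of \<open>v\<close> iff every walk from \<open>r\<close> to \<open>v\<close> visits \<open>u\<close>.\<close>

locale rooted_tree = pair_sym_digraph G for G :: "'a pair_pre_digraph" +
  fixes r :: 'a
  assumes root: "r \<in> pverts G"
    and spans: "\<And>v. v \<in> pverts G \<Longrightarrow> (r, v) \<in> (parcs G)\<^sup>*"
    and acyclic: "\<nexists>c. pre_digraph.cycle (with_proj G) c \<and> 3 \<le> length c"
begin

abbreviation R where "R \<equiv> parcs G"

section \<open>Domination and depth\<close>

definition ancestor :: "'a \<Rightarrow> 'a \<Rightarrow> bool" where
  "ancestor u v \<longleftrightarrow> \<not> reach R (- {u}) r v"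

definition depth :: "'a \<Rightarrow> nat" where
  "depth v = (LEAST n. (r, v) \<in> R ^^ n)"

lemma sym_R: "sym R"
  using arcs_symmetric by (auto simp: sym_def)

lemma depth_walk: "v \<in> pverts G \<Longrightarrow> (r, v) \<in> R ^^ depth v"
  unfolding depth_def using spans by (metis LeastI_ex rtrancl_imp_relpow)

lemma depth_le: "(r, v) \<in> R ^^ n \<Longrightarrow> depth v \<le> n"
  unfolding depth_def by (rule Least_le)

text \<open>A shortest walk from \<open>r\<close> to \<open>v\<close> must visit \<open>u\<close>,
  and does so before its last step.\<close>

lemma ancestor_depth_less:
  assumes "ancestor u v" "u \<noteq> v" "v \<in> pverts G"
  shows "depth u < depth v"
proof -
  have "reach R (- {u}) r v \<or> v = u \<or> (\<exists>m<n. (r, u) \<in> R ^^ m)" if "(r, v) \<in> R ^^ n" for n v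
    using that
  proof (induction n arbitrary: v)
    case 0
    then show ?case by (auto intro: reach_refl)
  next
    case (Suc n)
    then obtain v' where "(r, v') \<in> R ^^ n" "(v', v) \<in> R" by auto
    then show ?case using Suc.IH[of v'] reach_step[of R "- {u}" r v' v] by (auto intro: less_SucI)
  qed
  from this[OF depth_walk[OF assms(3)]] show ?thesis
    using assms by (auto simp: ancestor_def dest: depth_le)
qed

text \<open>If neither vertex dominated the other, every vertex of a walk to \<open>w\<close> could
  be reached avoiding \<open>u\<close> or avoiding \<open>v\<close>: on arrival at one of them,
  switch to the walk that reaches it while avoiding the other.\<close>

lemma ancestor_chain:
  assumes "ancestor u w" "ancestor v w" "w \<in> pverts G"
  shows "ancestor u v \<or> ancestor v u"
proof (rule ccontr)
  assume "\<not> ?thesis"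
  then have uv: "reach R (- {u}) r v" "reach R (- {v}) r u" by (auto simp: ancestor_def)
  have "reach R (- {u}) r w \<or> reach R (- {v}) r w"
    using spans[OF assms(3)]
  proof (induction rule: rtrancl_induct)
    case base
    then show ?case using reach_in(1)[OF uv(1)] by (auto intro: reach_refl)
  next
    case (step x y)
    then show ?case using uv reach_step[of R _ r x y] by blast
  qed
  then show False using assms by (auto simp: ancestor_def)
qed

lemma ancestor_if_depth_le:
  assumes "ancestor u w" "ancestor v w" "w \<in> pverts G" "u \<in> pverts G" "depth u \<le> depth v"
  shows "ancestor u v"
  using ancestor_chain[OF assms(1-3)] ancestor_depth_less[of v u] assms by fastforce

section \<open>Connected vertex sets and their apices\<close>

definition conn :: "'a set \<Rightarrow> bool" where
  "conn C \<longleftrightarrow> C \<noteq> {} \<and> C \<subseteq> pverts G \<and> (\<forall>u\<in>C. \<forall>v\<in>C. reach R C u v)"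

text \<open>If \<open>u\<close> were outside \<open>C\<close>, a walk inside \<open>C\<close> from
  \<open>a\<close> to \<open>v\<close> would avoid it, so \<open>u\<close> would dominate
  \<open>a\<close> as well. Mutual domination of distinct vertices contradicts the depths.\<close>

lemma conn_convex:
  assumes "conn C" "a \<in> C" "v \<in> C" "ancestor a u" "ancestor u v" "u \<in> pverts G"
  shows "u \<in> C"
proof (rule ccontr)
  assume "u \<notin> C"
  then have "reach R (- {u}) a v"
    using assms(1-3) reach_mono[of R C a v "- {u}"] by (auto simp: conn_def)
  then have "ancestor u a" using assms(5) by (auto simp: ancestor_def dest: reach_trans)
  moreover have "u \<noteq> a" "a \<in> pverts G" using \<open>u \<notin> C\<close> assms(1,2) by (auto simp: conn_def)
  ultimately show False
    using ancestor_depth_less[of u a] ancestor_depth_less[of a u] assms(4,6) by auto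
qed

text \<open>A vertex \<open>a\<close> of least depth works. A walk from \<open>r\<close> into
  \<open>C\<close> avoiding \<open>a\<close> would enter \<open>C\<close> at another vertex, and two
  entrances, joined once inside and once outside \<open>C\<close>, give a forbidden cycle.\<close>

lemma conn_has_apex:
  assumes "conn C"
  shows "\<exists>a\<in>C. \<forall>v\<in>C. ancestor a v"
proof -
  obtain a where a: "a \<in> C" "\<And>v. v \<in> C \<Longrightarrow> depth a \<le> depth v"
    using assms ex_has_least_nat[of "\<lambda>a. a \<in> C" _ depth] unfolding conn_def by blast
  have "ancestor a v" if "v \<in> C" for v
  proof (rule ccontr)
    assume "\<not> ?thesis"
    then have av: "reach R (- {a}) r v" by (simp add: ancestor_def)
    then have "r \<noteq> a" using reach_in by fastforce
    \<comment> \<open>Vertices of depth below the minimum lie outside \<open>C\<close>, so a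
      shortest walk to \<open>a\<close> enters \<open>C\<close> only at its end.\<close>
    have outside: "reach R (- C) r x" if "(r, x) \<in> R ^^ n" "n < depth a" for n x
      using that
    proof (induction n arbitrary: x)
      case 0
      then show ?case using a(2)[of r] depth_le[of r 0] by (auto intro: reach_refl)
    next
      case (Suc n)
      then obtain x' where x': "(r, x') \<in> R ^^ n" "(x', x) \<in> R" by auto
      have "x \<notin> C" using a(2)[of x] depth_le[OF Suc.prems(1)] Suc.prems(2) by auto
      then show ?case using Suc x' by (auto intro: reach_step)
    qed
    have "(r, a) \<in> R ^^ depth a" using depth_walk a assms by (auto simp: conn_def)
    moreover have "depth a \<noteq> 0" using calculation \<open>r \<noteq> a\<close> by (cases "depth a") auto
    ultimately obtain a' where a': "reach R (- C) r a'" "(a', a) \<in> R"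
      using outside by (cases "depth a") auto
    have "reach R (- C) r v \<or> (\<exists>w\<in>C. \<exists>w'. w \<noteq> a \<and> reach R (- C) r w' \<and> (w', w) \<in> R)"
      using av
    proof (induction rule: reach_induct)
      case refl
      then show ?case using reach_in[OF a'(1)] by (auto intro: reach_refl)
    next
      case (step v w)
      then show ?case by (cases "w \<in> C") (auto intro: reach_step)
    qed
    then obtain w w' where w: "w \<in> C" "w \<noteq> a" "reach R (- C) r w'" "(w', w) \<in> R"
      using reach_in(2)[of R "- C" r v] \<open>v \<in> C\<close> by auto
    have "a = w"
    proof (rule no_disjoint_detours[OF acyclic])
      show "reach R C a w" using assms a w by (auto simp: conn_def)
      show "reach R (- C) w' a'" using w(3) a'(1) by (meson reach_trans reach_sym sym_R)
    qed (use w a' arcs_symmetric in auto)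
    then show False using w by simp
  qed
  then show ?thesis using a(1) by blast
qed

definition apex :: "'a set \<Rightarrow> 'a" where
  "apex C = (SOME a. a \<in> C \<and> (\<forall>v\<in>C. ancestor a v))"

lemma apex: assumes "conn C" shows "apex C \<in> C" "\<And>v. v \<in> C \<Longrightarrow> ancestor (apex C) v"
  using someI_ex[of "\<lambda>a. a \<in> C \<and> (\<forall>v\<in>C. ancestor a v)"] conn_has_apex[OF assms]
  by (auto simp: apex_def)

text \<open>Both apices dominate the common vertex \<open>v\<close>, so they are comparable and the
  shallower one dominates the deeper. Convexity of \<open>C\<close> then captures
  \<open>apex C'\<close>.\<close>

lemma deeper_apex_in:
  assumes "conn C" "conn C'" "v \<in> C" "v \<in> C'" "depth (apex C) \<le> depth (apex C')"
  shows "apex C' \<in> C"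
proof -
  have in_G: "v \<in> pverts G" "apex C \<in> pverts G" "apex C' \<in> pverts G"
    using assms(1-3) apex(1)[OF assms(1)] apex(1)[OF assms(2)] unfolding conn_def by blast+
  have anc: "ancestor (apex C) v" "ancestor (apex C') v" using assms apex(2) by blast+
  have "ancestor (apex C) (apex C')"
    using ancestor_if_depth_le[OF anc in_G(1,2) assms(5)] .
  then show ?thesis using conn_convex[OF assms(1) apex(1)[OF assms(1)] assms(3) _ anc(2) in_G(3)] by blast
qed

end

text \<open>Any vertex can be the root. Connectedness refers to the symmetric closure, which has the
  same arcs as \<open>G\<close>.\<close>

lemma undirected_tree_rooted:
  assumes "undirected_tree G"
  shows "\<exists>r. rooted_tree G r"
proof -
  interpret pair_bidirected_digraph G using assms by (simp add: undirected_tree_def)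
  let ?M = "with_proj (mk_symmetric (with_proj G))"
  have arcs: "arcs_ends ?M = parcs G"
    using arcs_symmetric by (auto simp: mk_symmetric_def)
  have M: "strongly_connected ?M" using assms by (simp add: undirected_tree_def connected_def)
  then obtain r where "r \<in> verts ?M" by (auto simp: strongly_connected_def)
  moreover have "verts ?M = pverts G" by (simp add: mk_symmetric_def)
  ultimately have "r \<in> pverts G" "\<And>v. v \<in> pverts G \<Longrightarrow> r \<rightarrow>\<^sup>*\<^bsub>?M\<^esub> v"
    using M unfolding strongly_connected_def by simp_all
  then have "rooted_tree G r"
    using assms reachable_rtranclI[of ?M r] unfolding arcs
    by unfold_locales (simp_all add: undirected_tree_def)
  then show ?thesis by blast
qed

section \<open>The piercing number\<close>

text \<open>\<open>K / d\<close> is the value of \<open>B\<close> at which the second bound on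
  \<open>B\<close> in \<open>pq_piercing_set\<close> becomes an equality.\<close>

lemma bound_power_eq:
  fixes p q d :: nat
  assumes "q > 1" "d > 0" "p > 0"
  defines "K \<equiv> 2 powr (1 / (real q - 1)) * (exp 1 * real p) powr (real q / (real q - 1)) / real q
           * real d powr (real q / (real q - 1))"
  shows "(K / d) ^ (q - 1) = 2 * real d * real q * (exp 1 * p / q) ^ q"
proof -
  define s where "s = real q - 1"
  have s: "s > 0" "real (q - 1) = s" using assms by (auto simp: s_def)
  have pw: "(x powr (a / s)) ^ (q - 1) = x powr a" if "x > 0" for x a
    using that s by (simp add: powr_power)
  have split: "real q ^ q = real q * real q ^ (q - 1)" "real d ^ q = real d * real d ^ (q - 1)"
    using assms(1) by (simp_all add: power_eq_if)
  have "(K / d) ^ (q - 1) = 2 powr 1 * (exp 1 * real p) powr real q / real q ^ (q - 1)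
      * real d powr real q / real d ^ (q - 1)"
    using assms pw unfolding K_def s_def[symmetric] by (simp add: power_mult_distrib power_divide)
  also have "\<dots> = 2 * (exp 1 * real p) ^ q / real q ^ (q - 1) * real d ^ q / real d ^ (q - 1)"
    using assms by (simp add: powr_realpow)
  also have "\<dots> = 2 * real d * real q * (exp 1 * p / q) ^ q"
    using assms(1,2) unfolding power_divide split(1,2) by simp
  finally show ?thesis .
qed

theorem theorem1p4:
  fixes G :: "'a pair_pre_digraph"
    and H :: "'a pair_pre_digraph set"
    and p q d :: nat
  assumes "undirected_tree G"
    and "p \<ge> q" and "q > 1"
    and "finite H"
    and "\<And>S. S \<in> H \<Longrightarrow> undirected_subgraph S G"
    and "\<And>S. S \<in> H \<Longrightarrow> at_most_components d S"
    and "pq_property G p q H"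
  shows "real (piercing_number G H) \<le>
    max (2 powr (1 / (real q - 1)) * (exp 1 * real p) powr (real q / (real q - 1)) / real q
           * real d powr (real q / (real q - 1)) + real d)
        (2 * real p ^ 2 * real d)"
\<comment> \<open>A member of \<open>H\<close> is needed for the duality and to force
  \<open>d > 0\<close>.\<close>
proof (cases "H = {}")
  case True
  then have "piercing_number G H \<le> 0"
    unfolding piercing_number_def by (intro Least_le exI[of _ "{}"]) (simp add: piercing_set_def)
  then show ?thesis by (simp add: le_max_iff_disj)
next
  case False
  obtain r where "rooted_tree G r" using undirected_tree_rooted[OF assms(1)] by blast
  then interpret rooted_tree G r .
  define comps where "comps S = verts ` pre_digraph.sccs (with_proj S)" for S :: "'a pair_pre_digraph"
  have conn: "conn C" if "S \<in> H" "C \<in> comps S" for S C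
  proof -
    obtain D where D: "D \<in> pre_digraph.sccs (with_proj S)" "C = verts D"
      using \<open>C \<in> comps S\<close> by (auto simp: comps_def)
    have S: "subgraph (with_proj S) (with_proj G)"
      using assms(5) \<open>S \<in> H\<close> by (simp add: undirected_subgraph_def)
    have D': "strongly_connected D" "subgraph D (with_proj S)"
      using D(1) by (auto simp: pre_digraph.sccs_def induced_subgraph_def)
    have "arcs_ends D \<subseteq> parcs G"
      using S D'(2) by (force simp: subgraph_def compatible_def arcs_ends_conv)
    then have "\<forall>u\<in>C. \<forall>v\<in>C. reach (parcs G) C u v"
      using reach_if_strongly_connected[OF D'(1)] D(2) by blast
    moreover have "C \<noteq> {}" "C \<subseteq> pverts G"
      using S D' by (auto simp: D(2) subgraph_def strongly_connected_def)
    ultimately show ?thesis by (simp add: conn_def)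
  qed
  have cover: "\<Union>(comps S) = pverts S" if "S \<in> H" for S
  proof -
    interpret S: pair_sym_digraph S using assms(5) that by (simp add: undirected_subgraph_def)
    have "u \<in> \<Union>(comps S)" if "u \<in> pverts S" for u
    proof -
      have "{v. u \<rightarrow>\<^sup>*\<^bsub>with_proj S\<^esub> v} \<in> comps S"
        unfolding comps_def using S.induce_reachable_is_in_sccs[OF that]
        by (rule rev_image_eqI) simp
      moreover have "u \<rightarrow>\<^sup>*\<^bsub>with_proj S\<^esub> u" using S.reachable_refl that .
      ultimately show ?thesis by blast
    qed
    moreover have "\<Union>(comps S) \<subseteq> pverts S"
      unfolding comps_def pre_digraph.sccs_def induced_subgraph_def subgraph_def by auto
    ultimately show ?thesis by blast
  qed
  have fin: "finite (comps S)" "card (comps S) \<le> d" "comps S \<noteq> {}" if "S \<in> H" for S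
  proof -
    have "finite (pre_digraph.sccs (with_proj S))" "card (pre_digraph.sccs (with_proj S)) \<le> d"
      using assms(6)[OF that] by (auto simp: at_most_components_def)
    then show "finite (comps S)" "card (comps S) \<le> d"
      using card_image_le order_trans unfolding comps_def by blast+
    have "pverts S \<noteq> {}" using assms(5) that by (simp add: undirected_subgraph_def)
    then show "comps S \<noteq> {}" using cover[OF that] by auto
  qed
  obtain S0 where "S0 \<in> H" using False by blast
  then have "d > 0" using fin[of S0] by (metis card_gt_0_iff less_le_trans)
  define K where "K = 2 powr (1 / (real q - 1)) * (exp 1 * real p) powr (real q / (real q - 1)) / real q
           * real d powr (real q / (real q - 1))"
  \<comment> \<open>The least value meeting both bounds; multiplied by \<open>d\<close> it gives the
    two terms of the maximum, up to the summand \<open>d\<close>.\<close>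
  define B where "B = max (K / d) (2 * real p ^ 2)"
  have "K \<ge> 0" by (simp add: K_def)
  have "(K / d) ^ (q - 1) \<le> B ^ (q - 1)"
    using \<open>K \<ge> 0\<close> by (intro power_mono) (auto simp: B_def)
  then have B: "2 * real d * real q * (exp 1 * p / q) ^ q \<le> B ^ (q - 1)"
    using bound_power_eq[OF assms(3) \<open>d > 0\<close>, of p] assms(2,3) by (simp add: K_def)
  have "\<exists>Y. finite Y \<and> real (card Y) \<le> d * B \<and> Y \<subseteq> \<Union>(\<Union>(comps ` H)) \<and> (\<forall>S\<in>H. Y \<inter> \<Union>(comps S) \<noteq> {})"
  proof (rule pq_piercing_set[where apex = apex and rank = "\<lambda>C. depth (apex C)" and p = p and q = q])
    show "apex C \<in> C" if "C \<in> \<Union>(comps ` H)" for C using that conn apex(1) by blast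
    show "apex C' \<in> C" if "C \<in> \<Union>(comps ` H)" "C' \<in> \<Union>(comps ` H)" "C \<inter> C' \<noteq> {}"
      "depth (apex C) \<le> depth (apex C')" for C C'
      using that conn deeper_apex_in by blast
    show "\<exists>F'\<subseteq>F. card F' = q \<and> (\<exists>v. \<forall>S\<in>F'. v \<in> \<Union>(comps S))" if F: "F \<subseteq> H" "card F = p" for F
    proof -
      have "finite F" using F(1) assms(4) finite_subset by blast
      then obtain F' v where F': "F' \<subseteq> F" "card F' = q" "\<forall>S\<in>F'. v \<in> pverts S"
        using assms(7)[unfolded pq_property_def, rule_format, of F] F by blast
      then have "\<forall>S\<in>F'. v \<in> \<Union>(comps S)" using F(1) cover by blast
      then show ?thesis using F'(1,2) by blast
    qed
    show "2 * real p ^ 2 \<le> B" by (simp add: B_def)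
  qed (use assms False fin B in auto)
  then obtain Y where Y: "finite Y" "real (card Y) \<le> d * B" "Y \<subseteq> \<Union>(\<Union>(comps ` H))"
    "\<forall>S\<in>H. Y \<inter> \<Union>(comps S) \<noteq> {}" by blast
  have "\<Union>(\<Union>(comps ` H)) \<subseteq> pverts G" using conn unfolding conn_def by blast
  then have "piercing_set G H Y"
    unfolding piercing_set_def using Y(3,4) cover by simp
  then have "piercing_number G H \<le> card Y"
    unfolding piercing_number_def using Y(1) by (intro Least_le) blast
  then have "real (piercing_number G H) \<le> d * B" using Y(2) by linarith
  also have "d * B = max K (2 * real p ^ 2 * real d)"
    using \<open>d > 0\<close> by (simp add: B_def max_def field_simps)
  also have "\<dots> \<le> max (K + real d) (2 * real p ^ 2 * real d)" by (intro max.mono) auto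
  finally show ?thesis by (simp add: K_def)
qed

end
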